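(* Let $G$ be a simple connected graph with $|E(G)|\ge1$ and let $v\in V(G)$. Let $\bar G$ be obtained from $G$ by attaching three new pendant vertices $a,b,c$ to $v$, and let $G^*=\bar G+\{a,b\}+\{b,c\}+\{a,c\}$. Then $\mathscr{K}(G^* )\ge\mathscr{K}(\bar G)$, with equality if and only if $G=P_2$ (the graph with two vertices and one edge).
   Context: For connected $H$ with $m\ge1$ edges and degrees $d_i$, Kemeny's constant is $\mathscr{K}(H)=\sum_j\pi_jm_{ij}$ for the simple random walk on $H$ ($\pi_j=d_j/2m$, $m_{ij}$ expected hitting time of $j$ from $i$, $m_{jj}=0$), equivalently $\frac1{4m}\sum_{i,j}d_id_jr_H(i,j)$ with $r_H$ effective resistance. $H+\{x,y\}$ denotes $H$ with the edge $\{x,y\}$ added. *)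

theory Defs
  imports
    "HOL-Probability.Probability_Mass_Function"
    "Graph_Theory.Pair_Digraph"
    "Graph_Theory.Digraph_Component"
begin

text \<open>
  A finite simple graph is a \<open>pair_graph\<close>: a finite, loop-free, symmetric digraph without
  parallel arcs. An undirected edge \<open>{x, y}\<close> is the pair of arcs \<open>(x, y)\<close> and \<open>(y, x)\<close>, so the
  degree of a vertex is its out-degree, but the number of edges is not the number of arcs.
\<close>

definition edges :: "'a pair_pre_digraph \<Rightarrow> 'a set set" where
  "edges H = {{x, y} | x y. (x, y) \<in> parcs H}"

definition add_edge :: "'a pair_pre_digraph \<Rightarrow> 'a \<Rightarrow> 'a \<Rightarrow> 'a pair_pre_digraph" where
  "add_edge H x y = H\<lparr>parcs := parcs H \<union> {(x, y), (y, x)}\<rparr>"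

definition add_pendant :: "'a pair_pre_digraph \<Rightarrow> 'a \<Rightarrow> 'a \<Rightarrow> 'a pair_pre_digraph" where
  "add_pendant H v x = add_edge (H\<lparr>pverts := insert x (pverts H)\<rparr>) v x"

definition is_P2 :: "'a pair_pre_digraph \<Rightarrow> bool" where
  "is_P2 H \<longleftrightarrow> (\<exists>u w. u \<noteq> w \<and> H = \<lparr>pverts = {u, w}, parcs = {(u, w), (w, u)}\<rparr>)"

definition rw_step :: "'a pair_pre_digraph \<Rightarrow> 'a \<Rightarrow> 'a pmf" where
  "rw_step H i = pmf_of_set {k. (i, k) \<in> parcs H}"

text \<open>The law of the trajectory \<open>[X\<^sub>0, \<dots>, X\<^sub>n]\<close> of the simple random walk with \<open>X\<^sub>0 = i\<close>.\<close>

primrec rw_path :: "'a pair_pre_digraph \<Rightarrow> nat \<Rightarrow> 'a \<Rightarrow> 'a list pmf" where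
  "rw_path H 0 i = return_pmf [i]"
| "rw_path H (Suc n) i = bind_pmf (rw_step H i) (\<lambda>k. map_pmf (\<lambda>xs. i # xs) (rw_path H n k))"

text \<open>The probability that the walk started at \<open>i\<close> visits \<open>j\<close> for the first time at time \<open>n\<close>.\<close>

definition first_hit_prob :: "'a pair_pre_digraph \<Rightarrow> 'a \<Rightarrow> 'a \<Rightarrow> nat \<Rightarrow> real" where
  "first_hit_prob H i j n =
     measure_pmf.prob (rw_path H n i) {xs. xs ! n = j \<and> (\<forall>k<n. xs ! k \<noteq> j)}"

text \<open>
  On a finite connected graph the hitting time is almost surely finite and has finite
  expectation, so the series below converges to that expectation. Time \<open>0\<close> counts as a hit,
  whence the value is \<open>0\<close> for \<open>i = j\<close>.
\<close>

definition hitting_time :: "'a pair_pre_digraph \<Rightarrow> 'a \<Rightarrow> 'a \<Rightarrow> real" where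
  "hitting_time H i j = (\<Sum>n. real n * first_hit_prob H i j n)"

definition stationary :: "'a pair_pre_digraph \<Rightarrow> 'a \<Rightarrow> real" where
  "stationary H j = real (out_degree (with_proj H) j) / (2 * real (card (edges H)))"

text \<open>
  For a connected graph with at least one edge the sum does not depend on the starting
  vertex \<open>i\<close>; Kemeny's constant is the common value.
\<close>

definition kemeny :: "'a pair_pre_digraph \<Rightarrow> real" where
  "kemeny H =
     (THE K. \<forall>i\<in>pverts H. K = (\<Sum>j\<in>pverts H. stationary H j * hitting_time H i j))"

end

theory Submission
  imports Defs
begin

text \<open>
  On a connected graph with \<open>m\<close> edges the hitting times of a vertex \<open>j\<close> are the unique solution of
  a Poisson equation: the Laplacian of \<open>h(\<sqdot>, j)\<close> is the degree function minus \<open>2 m\<close> times the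
  indicator of \<open>j\<close>. Hence \<open>\<Sum>\<^sub>j d\<^sub>j h(\<sqdot>, j)\<close> is harmonic, so constant, and Kemeny's constant is
  well defined.

  If \<open>G\<close> and \<open>B\<close>, with \<open>m\<close> and \<open>n\<close> edges, share just the vertex \<open>v\<close>, the Poisson equation of their
  union is solved explicitly in terms of the hitting times of the two parts. This gives
  \<open>K(G \<union> B) = K(G) + K(B) + (n \<alpha>(G) + m \<alpha>(B)) / (m + n)\<close>, where \<open>\<alpha>\<close> is the expected time to reach
  \<open>v\<close> from a stationary starting vertex. The two graphs to be compared are the unions of \<open>G\<close> with a
  star with three leaves (\<open>n = 3\<close>, \<open>K = 5/2\<close>, \<open>\<alpha> = 1/2\<close>) and with a complete graph on four vertices
  (\<open>n = 6\<close>, \<open>K = \<alpha> = 9/4\<close>), and the difference of their Kemeny constants is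
  \<open>(3 m \<alpha>(G) + 3/2 (m\<^sup>2 + m - 3)) / ((m + 3) (m + 6))\<close>. It is positive for \<open>m \<ge> 2\<close>, and it
  vanishes for \<open>m = 1\<close>, where \<open>G\<close> is a single edge and \<open>\<alpha>(G) = 1/2\<close>.
\<close>

section \<open>Hitting times of the simple random walk\<close>

definition nbrs :: "'a pair_pre_digraph \<Rightarrow> 'a \<Rightarrow> 'a set" where
  "nbrs H i = {k. (i, k) \<in> parcs H}"

lemma out_degree_eq_card_nbrs: "out_degree (with_proj H) i = card (nbrs H i)"
proof -
  have "out_arcs (with_proj H) i = Pair i ` nbrs H i"
    by (auto simp: out_arcs_def nbrs_def)
  then show ?thesis
    by (simp add: out_degree_def card_image inj_on_def)
qed

text \<open>Mapping the event to a Boolean turns its measure into a point mass, where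
  \<open>pmf_bind\<close> applies. This is the tool for conditioning on the first step.\<close>

lemma measure_bind_pmf:
  "measure (measure_pmf (bind_pmf M N)) X = (\<integral>x. measure (measure_pmf (N x)) X \<partial>measure_pmf M)"
proof -
  have as_pmf: "measure (measure_pmf P) X = pmf (map_pmf (\<lambda>x. x \<in> X) P) True" for P
    by (simp add: pmf_map vimage_def)
  show ?thesis
    by (simp add: as_pmf map_bind_pmf pmf_bind)
qed

text \<open>Connectivity is phrased through \<open>rtrancl\<close>, so that distances can be read
  off the powers of the arc relation.\<close>

locale walk_graph = pair_graph G for G :: "'a pair_pre_digraph" +
  assumes parcs_nonempty: "parcs G \<noteq> {}"
    and connected: "\<lbrakk>x \<in> pverts G; y \<in> pverts G\<rbrakk> \<Longrightarrow> (x, y) \<in> (parcs G)\<^sup>*"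
begin

section \<open>Degrees and arc counting\<close>

lemma nbrs_subset: "nbrs G i \<subseteq> pverts G"
  using in_arcsD2 by (auto simp: nbrs_def)

lemma finite_nbrs: "finite (nbrs G i)"
  using nbrs_subset pair_finite_verts by (rule finite_subset)

lemma nbrs_sym: "k \<in> nbrs G i \<longleftrightarrow> i \<in> nbrs G k"
  using arcs_symmetric by (auto simp: nbrs_def)

lemma nbrs_in_verts: "k \<in> nbrs G i \<Longrightarrow> k \<in> pverts G"
  using nbrs_subset by blast

text \<open>An arc has two distinct ends, so some vertex differs from \<open>i\<close>, and a path
  to it starts with an arc leaving \<open>i\<close>.\<close>

lemma nbrs_nonempty:
  assumes "i \<in> pverts G"
  shows "nbrs G i \<noteq> {}"
proof -
  obtain x y where xy: "(x, y) \<in> parcs G"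
    using parcs_nonempty by auto
  then have "x \<noteq> y" "x \<in> pverts G" "y \<in> pverts G"
    using no_loops' in_arcsD1 in_arcsD2 by blast+
  then obtain z where "z \<in> pverts G" "z \<noteq> i"
    by metis
  then have "(i, z) \<in> (parcs G)\<^sup>*"
    using connected assms by blast
  then show ?thesis
    using \<open>z \<noteq> i\<close> by (cases rule: converse_rtranclE) (auto simp: nbrs_def)
qed

lemma card_nbrs_pos: "i \<in> pverts G \<Longrightarrow> 0 < card (nbrs G i)"
  using nbrs_nonempty finite_nbrs by (simp add: card_gt_0_iff)

text \<open>Double counting: by symmetry the term \<open>f k\<close> occurs once for each neighbour
  of \<open>k\<close>.\<close>

lemma sum_sum_nbrs:
  fixes f :: "'a \<Rightarrow> real"
  shows "(\<Sum>i\<in>pverts G. \<Sum>k\<in>nbrs G i. f k) = (\<Sum>k\<in>pverts G. real (card (nbrs G k)) * f k)"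
proof -
  have "(\<Sum>i\<in>pverts G. \<Sum>k\<in>nbrs G i. f k) = (\<Sum>i\<in>pverts G. \<Sum>k\<in>{k\<in>pverts G. k \<in> nbrs G i}. f k)"
    by (intro sum.cong) (auto intro: nbrs_in_verts)
  also have "\<dots> = (\<Sum>k\<in>pverts G. \<Sum>i\<in>{i\<in>pverts G. k \<in> nbrs G i}. f k)"
    by (rule sum.swap_restrict) (rule pair_finite_verts)+
  also have "\<dots> = (\<Sum>k\<in>pverts G. \<Sum>i\<in>nbrs G k. f k)"
    by (intro sum.cong) (auto simp: nbrs_sym intro: nbrs_in_verts)
  finally show ?thesis by simp
qed

lemma card_parcs_eq_sum: "card (parcs G) = (\<Sum>i\<in>pverts G. card (nbrs G i))"
proof -
  have "parcs G = Sigma (pverts G) (nbrs G)"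
    using in_arcsD1 by (auto simp: nbrs_def)
  then show ?thesis
    using pair_finite_verts finite_nbrs by simp
qed

lemma card_parcs_pos: "0 < card (parcs G)"
  using parcs_nonempty pair_finite_arcs by (simp add: card_gt_0_iff)

lemma card_parcs_eq: "card (parcs G) = 2 * card (edges G)"
proof -
  let ?f = "\<lambda>(x, y). {x, y}"
  have img: "edges G = ?f ` parcs G"
    by (auto simp: edges_def image_iff)
  have fibre: "card {p \<in> parcs G. ?f p = e} = 2" if "e \<in> edges G" for e
  proof -
    obtain x y where e: "e = {x, y}" "(x, y) \<in> parcs G"
      using \<open>e \<in> edges G\<close> by (auto simp: edges_def)
    then have "{p \<in> parcs G. ?f p = e} = {(x, y), (y, x)}"
      using arcs_symmetric by (auto simp: doubleton_eq_iff)
    moreover have "x \<noteq> y"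
      using e no_loops' by blast
    ultimately show ?thesis by simp
  qed
  have "card (parcs G) = (\<Sum>e\<in>edges G. card {p \<in> parcs G. ?f p = e})"
    using sum.group[of "parcs G" "edges G" ?f "\<lambda>_. 1::nat"] pair_finite_arcs
    by (simp add: img)
  then show ?thesis
    using fibre by simp
qed

lemma stationary_eq: "stationary G j = real (card (nbrs G j)) / real (card (parcs G))"
  by (simp add: stationary_def out_degree_eq_card_nbrs card_parcs_eq)

section \<open>First-passage probabilities\<close>

lemma first_hit_prob_0: "first_hit_prob G i j 0 = (if i = j then 1 else 0)"
  by (simp add: first_hit_prob_def)

lemma first_hit_prob_Suc:
  assumes "i \<in> pverts G"
  shows "first_hit_prob G i j (Suc n) =
    (if i = j then 0 else (\<Sum>k\<in>nbrs G i. first_hit_prob G k j n) / card (nbrs G i))"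
proof -
  let ?E = "\<lambda>n. {xs. xs ! n = j \<and> (\<forall>k<n. xs ! k \<noteq> j)}"
  \<comment> \<open>The prefix \<open>i\<close> shifts all times by one, and for
    \<open>i = j\<close> it is already a hit at time 0, which excludes a later first hit.\<close>
  have pre: "(\<lambda>xs. i # xs) -` ?E (Suc n) = (if i = j then {} else ?E n)"
    by (auto simp: less_Suc_eq_0_disj)
  have "first_hit_prob G i j (Suc n) =
      (\<integral>k. measure (measure_pmf (rw_path G n k)) (if i = j then {} else ?E n) \<partial>measure_pmf (rw_step G i))"
    unfolding first_hit_prob_def rw_path.simps measure_bind_pmf measure_map_pmf pre ..
  also have "\<dots> = (if i = j then 0 else (\<Sum>k\<in>nbrs G i. first_hit_prob G k j n) / card (nbrs G i))"
    using integral_pmf_of_set[OF nbrs_nonempty[OF assms] finite_nbrs]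
    by (simp add: rw_step_def first_hit_prob_def flip: nbrs_def)
  finally show ?thesis .
qed

lemma first_hit_prob_nonneg: "0 \<le> first_hit_prob G i j n"
  by (simp add: first_hit_prob_def)

text \<open>
  The function \<open>K (1 - q ^ rank)\<close>, with \<open>rank\<close> the distance to \<open>j\<close> and \<open>q\<close> small, dominates the
  hitting time: it exceeds its average over the neighbours by at least 1.
\<close>

lemma ex_supersolution:
  assumes j: "j \<in> pverts G"
  obtains f :: "'a \<Rightarrow> real"
  where "\<And>i. 0 \<le> f i"
    and "\<And>i. i \<in> pverts G \<Longrightarrow> i \<noteq> j \<Longrightarrow>
      card (nbrs G i) + (\<Sum>k\<in>nbrs G i. f k) \<le> card (nbrs G i) * f i"
proof -
  define rank where "rank i = (LEAST n. (i, j) \<in> parcs G ^^ n)" for i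
  \<comment> \<open>Since \<open>2 * card (parcs G) * q = 1\<close>, a single neighbour closer to
    \<open>j\<close> contributes \<open>2 * card (parcs G)\<close> times \<open>q ^ rank i\<close>:
    one half pays for the degree many terms at \<open>i\<close>, the other half for the required
    gain.\<close>
  define q :: real where "q = 1 / (2 * card (parcs G))"
  define R where "R = Max (rank ` pverts G)"
  \<comment> \<open>This makes \<open>K * q ^ rank i\<close> at least \<open>card (parcs G)\<close>
    for every rank up to the maximum \<open>R\<close>.\<close>
  define K where "K = card (parcs G) / q ^ R"
  define f where "f i = K * (1 - q ^ rank i)" for i
  have A: "1 \<le> real (card (parcs G))"
    using card_parcs_pos by simp
  then have q: "0 < q" "q \<le> 1"
    by (auto simp: q_def divide_simps)
  have K: "0 < K"
    using A q by (simp add: K_def)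
  have closer: "\<exists>k\<in>nbrs G i. rank i = Suc (rank k)" if "i \<in> pverts G" "i \<noteq> j" for i
  proof -
    have "\<exists>n. (i, j) \<in> parcs G ^^ n"
      using connected[OF that(1) j] by (simp add: rtrancl_power)
    then have "(i, j) \<in> parcs G ^^ rank i"
      unfolding rank_def by (rule LeastI_ex)
    moreover have "rank i \<noteq> 0"
      using calculation \<open>i \<noteq> j\<close> by (metis pair_in_Id_conv relpow.simps(1))
    ultimately obtain m k where m: "rank i = Suc m" and k: "(i, k) \<in> parcs G" "(k, j) \<in> parcs G ^^ m"
      by (metis not0_implies_Suc relpow_Suc_D2)
    have "rank k \<le> m"
      unfolding rank_def using k(2) by (rule Least_le)
    moreover have "(k, j) \<in> parcs G ^^ rank k"
      unfolding rank_def using k(2) by (rule LeastI)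
    then have "(i, j) \<in> parcs G ^^ Suc (rank k)"
      using k(1) by (rule relpow_Suc_I2[rotated])
    then have "rank i \<le> Suc (rank k)"
      unfolding rank_def[of i] by (rule Least_le)
    ultimately show ?thesis
      using k m by (auto simp: nbrs_def)
  qed
  show ?thesis
  proof
    fix i
    show "0 \<le> f i"
      using K q by (simp add: f_def power_le_one)
  next
    fix i assume i: "i \<in> pverts G" "i \<noteq> j"
    let ?d = "real (card (nbrs G i))"
    obtain k where k: "k \<in> nbrs G i" "rank i = Suc (rank k)"
      using closer i by blast
    have "card (nbrs G i) \<le> card (parcs G)"
      unfolding card_parcs_eq_sum using i pair_finite_verts by (intro member_le_sum) auto
    then have d: "?d \<le> card (parcs G)"
      by simp
    have "rank i \<le> R"
      using i pair_finite_verts by (simp add: R_def)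
    then have "q ^ R \<le> q ^ rank i"
      using q by (intro power_decreasing) auto
    then have Kq: "card (parcs G) \<le> K * q ^ rank i"
      using q A by (simp add: K_def field_simps)
    have "2 * card (parcs G) * q ^ rank i = q ^ rank k"
      using parcs_nonempty pair_finite_arcs by (simp add: k(2) q_def)
    also have "\<dots> \<le> (\<Sum>k\<in>nbrs G i. q ^ rank k)"
      using k(1) finite_nbrs q by (intro member_le_sum) auto
    finally have "K * (2 * card (parcs G) * q ^ rank i) \<le> K * (\<Sum>k\<in>nbrs G i. q ^ rank k)"
      using K by simp
    moreover have "?d * (K * q ^ rank i) \<le> card (parcs G) * (K * q ^ rank i)"
      using d K q by (intro mult_right_mono) auto
    moreover have "?d * 1 \<le> card (parcs G) * (K * q ^ rank i)"
      using d Kq A by (intro mult_mono) auto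
    ultimately show "?d + (\<Sum>k\<in>nbrs G i. f k) \<le> ?d * f i"
      by (simp add: f_def sum_subtractf right_diff_distrib flip: sum_distrib_left)
        (simp add: algebra_simps)
  qed
qed

text \<open>Maximum principle: subtracting a small multiple of the supersolution makes
  \<open>D\<close> strictly subharmonic off \<open>j\<close>, so its maximum lies at
  \<open>j\<close>, where it is at most 0. Then the multiple tends to 0.\<close>

lemma harmonic_nonpos:
  fixes D :: "'a \<Rightarrow> real"
  assumes j: "j \<in> pverts G" and Dj: "D j = 0"
    and harm: "\<And>i. i \<in> pverts G \<Longrightarrow> i \<noteq> j \<Longrightarrow> card (nbrs G i) * D i = (\<Sum>k\<in>nbrs G i. D k)"
    and i: "i \<in> pverts G"
  shows "D i \<le> 0"
proof -
  obtain f :: "'a \<Rightarrow> real" where f: "\<And>i. 0 \<le> f i"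
    "\<And>i. i \<in> pverts G \<Longrightarrow> i \<noteq> j \<Longrightarrow>
      card (nbrs G i) + (\<Sum>k\<in>nbrs G i. f k) \<le> card (nbrs G i) * f i"
    using ex_supersolution[OF j] by blast
  have "D i \<le> 0 + e" if "0 < e" for e
  proof -
    \<comment> \<open>The summand 1 keeps the denominator positive when
      \<open>f i = 0\<close>.\<close>
    define t where "t = e / (f i + 1)"
    have t: "0 < t" "t * f i \<le> e"
      using f(1)[of i] \<open>0 < e\<close> by (auto simp: t_def field_simps)
    define E where "E x = D x - t * f x" for x
    have "Max (E ` pverts G) \<in> E ` pverts G"
      using i pair_finite_verts by (intro Max_in) auto
    then obtain x where x: "x \<in> pverts G" and "E x = Max (E ` pverts G)"
      by auto
    then have max: "E y \<le> E x" if "y \<in> pverts G" for y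
      using that pair_finite_verts by simp
    have "x = j"
    proof (rule ccontr)
      assume "x \<noteq> j"
      have "(\<Sum>k\<in>nbrs G x. E k) \<le> card (nbrs G x) * E x"
        using max nbrs_in_verts by (intro sum_bounded_above) blast
      moreover have "t * (card (nbrs G x) + (\<Sum>k\<in>nbrs G x. f k)) \<le> t * (card (nbrs G x) * f x)"
        using f(2)[OF x \<open>x \<noteq> j\<close>] t by simp
      ultimately have "t * card (nbrs G x) \<le> 0"
        using harm[OF x \<open>x \<noteq> j\<close>]
        by (simp add: E_def sum_subtractf algebra_simps flip: sum_distrib_left)
      then show False
        using t card_nbrs_pos[OF x] by (simp add: mult_le_0_iff)
    qed
    then have "E i \<le> E j"
      using max i by blast
    also have "\<dots> \<le> 0"
      using t f(1)[of j] by (simp add: E_def Dj)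
    finally show ?thesis
      using t by (simp add: E_def)
  qed
  then show ?thesis
    by (rule field_le_epsilon)
qed

lemma harmonic_eq_0:
  fixes D :: "'a \<Rightarrow> real"
  assumes "j \<in> pverts G" "D j = 0"
    and "\<And>i. i \<in> pverts G \<Longrightarrow> i \<noteq> j \<Longrightarrow> card (nbrs G i) * D i = (\<Sum>k\<in>nbrs G i. D k)"
    and "i \<in> pverts G"
  shows "D i = 0"
proof (rule antisym)
  show "D i \<le> 0"
    using assms by (rule harmonic_nonpos)
  show "0 \<le> D i"
    using harmonic_nonpos[of j "\<lambda>x. - D x" i] assms by (simp add: sum_negf)
qed

section \<open>Convergence of the first-passage series\<close>

lemma sum_first_hit_prob_le_1: "i \<in> pverts G \<Longrightarrow> (\<Sum>n<N. first_hit_prob G i j n) \<le> 1"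
proof (induction N arbitrary: i)
  case (Suc N)
  have "(\<Sum>k\<in>nbrs G i. \<Sum>n<N. first_hit_prob G k j n) \<le> (\<Sum>k\<in>nbrs G i. 1)"
    using Suc.IH nbrs_in_verts by (intro sum_mono) blast
  then have "(\<Sum>n<N. \<Sum>k\<in>nbrs G i. first_hit_prob G k j n) \<le> card (nbrs G i)"
    by (subst sum.swap) simp
  then show ?case
    using card_nbrs_pos[OF Suc.prems]
    by (simp add: sum.lessThan_Suc_shift first_hit_prob_0 first_hit_prob_Suc[OF Suc.prems]
        del: sum.lessThan_Suc flip: sum_divide_distrib)
qed simp

lemma summable_first_hit_prob:
  assumes "i \<in> pverts G"
  shows "summable (first_hit_prob G i j)"
  using sum_first_hit_prob_le_1[OF assms] by (rule summableI_nonneg_bounded[OF first_hit_prob_nonneg])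

text \<open>By induction on \<open>N\<close>, for all starting vertices at once, the supersolution
  bounds the partial sums.\<close>

lemma summable_hitting_time:
  assumes i: "i \<in> pverts G" and j: "j \<in> pverts G"
  shows "summable (\<lambda>n. real n * first_hit_prob G i j n)"
proof -
  obtain f :: "'a \<Rightarrow> real" where f: "\<And>i. 0 \<le> f i"
    "\<And>i. i \<in> pverts G \<Longrightarrow> i \<noteq> j \<Longrightarrow>
      card (nbrs G i) + (\<Sum>k\<in>nbrs G i. f k) \<le> card (nbrs G i) * f i"
    using ex_supersolution[OF j] by blast
  have "(\<Sum>n<N. real n * first_hit_prob G i j n) \<le> f i" for N
    using i
  proof (induction N arbitrary: i)
    case (Suc N)
    show ?case
    proof (cases "i = j")
      case True
      then show ?thesis
        using f(1)[of i] Suc.prems by (simp add: sum.lessThan_Suc_shift first_hit_prob_Suc del: sum.lessThan_Suc)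
    next
      case False
      let ?d = "real (card (nbrs G i))"
      have d: "0 < ?d"
        using card_nbrs_pos[OF Suc.prems] by simp
      have "?d * (\<Sum>n<Suc N. real n * first_hit_prob G i j n) =
          (\<Sum>n<N. real (Suc n) * (\<Sum>k\<in>nbrs G i. first_hit_prob G k j n))"
        using d False Suc.prems
        by (simp add: sum.lessThan_Suc_shift first_hit_prob_Suc del: sum.lessThan_Suc of_nat_Suc
            flip: sum_divide_distrib)
      \<comment> \<open>Splitting \<open>Suc n\<close> into \<open>1 + n\<close> separates the step
        just made from the remaining time.\<close>
      also have "\<dots> = (\<Sum>k\<in>nbrs G i. (\<Sum>n<N. first_hit_prob G k j n) +
          (\<Sum>n<N. real n * first_hit_prob G k j n))"
        unfolding sum_distrib_left
        by (subst sum.swap) (simp add: algebra_simps flip: sum.distrib)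
      also have "\<dots> \<le> (\<Sum>k\<in>nbrs G i. 1 + f k)"
        using Suc.IH sum_first_hit_prob_le_1 nbrs_in_verts by (intro sum_mono add_mono) blast+
      also have "\<dots> = ?d + (\<Sum>k\<in>nbrs G i. f k)"
        by (simp add: sum.distrib)
      also have "\<dots> \<le> ?d * f i"
        using f(2) Suc.prems False by blast
      finally show ?thesis
        using d by simp
    qed
  qed (simp add: f)
  then show ?thesis
    by (intro summableI_nonneg_bounded[where x = "f i"]) (auto simp: first_hit_prob_nonneg)
qed

text \<open>The hitting probability minus 1 is harmonic off \<open>j\<close> and vanishes at
  \<open>j\<close>, so the walk hits \<open>j\<close> almost surely.\<close>

lemma suminf_first_hit_prob:
  assumes i: "i \<in> pverts G" and j: "j \<in> pverts G"
  shows "(\<Sum>n. first_hit_prob G i j n) = 1"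
proof -
  let ?P = "\<lambda>i. \<Sum>n. first_hit_prob G i j n"
  have shift: "?P i = first_hit_prob G i j 0 + (\<Sum>n. first_hit_prob G i j (Suc n))"
    if "i \<in> pverts G" for i
    using suminf_split_head[OF summable_first_hit_prob[OF that]] by simp
  have "?P i - 1 = 0"
    using j _ _ i
  proof (rule harmonic_eq_0)
    show "?P j - 1 = 0"
      using shift[OF j] j by (simp add: first_hit_prob_0 first_hit_prob_Suc)
  next
    fix i assume i: "i \<in> pverts G" "i \<noteq> j"
    have "?P i = (\<Sum>n. (\<Sum>k\<in>nbrs G i. first_hit_prob G k j n) / card (nbrs G i))"
      using shift i by (simp add: first_hit_prob_0 first_hit_prob_Suc)
    also have "\<dots> = (\<Sum>k\<in>nbrs G i. ?P k) / card (nbrs G i)"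
      using nbrs_in_verts
      by (subst suminf_divide) (auto simp: suminf_sum summable_first_hit_prob intro!: summable_sum)
    finally show "card (nbrs G i) * (?P i - 1) = (\<Sum>k\<in>nbrs G i. ?P k - 1)"
      using card_nbrs_pos[OF i(1)] by (simp add: sum_subtractf right_diff_distrib)
  qed
  then show ?thesis by simp
qed

section \<open>The Poisson equation of the hitting times\<close>

lemma hitting_time_self:
  assumes "j \<in> pverts G"
  shows "hitting_time G j j = 0"
proof -
  have "(\<lambda>n. real n * first_hit_prob G j j n) = (\<lambda>n. 0)"
  proof
    show "real n * first_hit_prob G j j n = 0" for n
      using assms by (cases n) (simp_all add: first_hit_prob_Suc)
  qed
  then show ?thesis
    by (simp add: hitting_time_def)
qed

lemma hitting_time_nonneg:
  assumes "i \<in> pverts G" "j \<in> pverts G"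
  shows "0 \<le> hitting_time G i j"
  unfolding hitting_time_def using summable_hitting_time[OF assms]
  by (intro suminf_nonneg) (auto simp: first_hit_prob_nonneg)

text \<open>First-step analysis; each neighbour contributes a 1 because its first-passage law has
  total mass 1.\<close>

lemma hitting_time_step:
  assumes i: "i \<in> pverts G" and j: "j \<in> pverts G" and "i \<noteq> j"
  shows "card (nbrs G i) * hitting_time G i j = card (nbrs G i) + (\<Sum>k\<in>nbrs G i. hitting_time G k j)"
proof -
  let ?p = "\<lambda>k. first_hit_prob G k j"
  have sums: "(\<lambda>n. real (Suc n) * ?p k n) sums (1 + hitting_time G k j)" if "k \<in> nbrs G i" for k
  proof -
    have k: "k \<in> pverts G"
      using that by (rule nbrs_in_verts)
    have "(\<lambda>n. ?p k n + real n * ?p k n) sums (1 + hitting_time G k j)"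
      unfolding hitting_time_def suminf_first_hit_prob[OF k j, symmetric]
      using summable_first_hit_prob[OF k] summable_hitting_time[OF k j] by (intro sums_add summable_sums)
    then show ?thesis
      by (simp add: algebra_simps)
  qed
  have "(\<lambda>n. (\<Sum>k\<in>nbrs G i. real (Suc n) * ?p k n) / card (nbrs G i)) sums
      ((\<Sum>k\<in>nbrs G i. 1 + hitting_time G k j) / card (nbrs G i))"
    using sums by (intro sums_divide sums_sum)
  then have "(\<lambda>n. real (Suc n) * ?p i (Suc n)) sums
      ((\<Sum>k\<in>nbrs G i. 1 + hitting_time G k j) / card (nbrs G i))"
    using i \<open>i \<noteq> j\<close> by (simp add: first_hit_prob_Suc sum_distrib_left del: of_nat_Suc)
  \<comment> \<open>The series may start at index 0 because the factor \<open>real n\<close>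
    vanishes there.\<close>
  then have "(\<lambda>n. real n * ?p i n) sums ((\<Sum>k\<in>nbrs G i. 1 + hitting_time G k j) / card (nbrs G i))"
    by (subst (asm) sums_Suc_iff) simp
  then have "hitting_time G i j = (\<Sum>k\<in>nbrs G i. 1 + hitting_time G k j) / card (nbrs G i)"
    unfolding hitting_time_def by (rule sums_unique[symmetric])
  then show ?thesis
    using card_nbrs_pos[OF i] by (simp add: sum.distrib)
qed

text \<open>The difference of two solutions is harmonic off \<open>j\<close>. Explicit hitting times
  are obtained below by checking a guessed \<open>f\<close>.\<close>

lemma hitting_time_unique:
  fixes f :: "'a \<Rightarrow> real"
  assumes j: "j \<in> pverts G" and "f j = 0"
    and f: "\<And>i. i \<in> pverts G \<Longrightarrow> i \<noteq> j \<Longrightarrow>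
      card (nbrs G i) * f i = card (nbrs G i) + (\<Sum>k\<in>nbrs G i. f k)"
    and i: "i \<in> pverts G"
  shows "hitting_time G i j = f i"
proof -
  have "hitting_time G i j - f i = 0"
    using j _ _ i
  proof (rule harmonic_eq_0)
    show "hitting_time G j j - f j = 0"
      using assms by (simp add: hitting_time_self)
  next
    fix i assume "i \<in> pverts G" "i \<noteq> j"
    then show "card (nbrs G i) * (hitting_time G i j - f i) = (\<Sum>k\<in>nbrs G i. hitting_time G k j - f k)"
      using f hitting_time_step j by (simp add: right_diff_distrib sum_subtractf)
  qed
  then show ?thesis by simp
qed

text \<open>The Laplacian of any function sums to 0 over all vertices, so the equations off
  \<open>j\<close> force its value at \<open>j\<close>. This is Kac's formula: the mean return time
  to \<open>j\<close> is \<open>card (parcs G)\<close> divided by the degree of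
  \<open>j\<close>.\<close>

lemma hitting_time_step_target:
  assumes j: "j \<in> pverts G"
  shows "(\<Sum>k\<in>nbrs G j. hitting_time G k j) = real (card (parcs G)) - card (nbrs G j)"
proof -
  let ?h = "\<lambda>i. hitting_time G i j" and ?d = "\<lambda>i. real (card (nbrs G i))"
  have "(\<Sum>i\<in>pverts G. ?d i * ?h i) = (\<Sum>i\<in>pverts G - {j}. ?d i * ?h i)"
    using j pair_finite_verts by (simp add: sum.remove hitting_time_self)
  also have "\<dots> = (\<Sum>i\<in>pverts G - {j}. ?d i + (\<Sum>k\<in>nbrs G i. ?h k))"
    using hitting_time_step j by (intro sum.cong) auto
  also have "\<dots> = (\<Sum>i\<in>pverts G. ?d i) - ?d j +
      ((\<Sum>i\<in>pverts G. \<Sum>k\<in>nbrs G i. ?h k) - (\<Sum>k\<in>nbrs G j. ?h k))"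
    using j pair_finite_verts by (simp add: sum.distrib sum_diff1)
  finally show ?thesis
    by (simp add: sum_sum_nbrs card_parcs_eq_sum)
qed

lemma hitting_time_laplacian:
  assumes "i \<in> pverts G" "j \<in> pverts G"
  shows "card (nbrs G i) * hitting_time G i j =
    card (nbrs G i) + (\<Sum>k\<in>nbrs G i. hitting_time G k j) - (if i = j then card (parcs G) else 0)"
  using hitting_time_step[OF assms] hitting_time_step_target[OF assms(2)] hitting_time_self[OF assms(2)]
  by auto

text \<open>In the Laplacian of \<open>S\<close>, the degree terms add up to
  \<open>card (parcs G)\<close> times the degree of \<open>i\<close>, which the correction at the
  target \<open>j = i\<close> cancels. Hence \<open>S\<close> is constant and any starting vertex
  may be used.\<close>

lemma kemeny_eq:
  assumes i: "i \<in> pverts G"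
  shows "kemeny G = (\<Sum>j\<in>pverts G. card (nbrs G j) * hitting_time G i j) / card (parcs G)"
proof -
  let ?d = "\<lambda>i. real (card (nbrs G i))" and ?h = "hitting_time G"
  define S where "S i = (\<Sum>j\<in>pverts G. ?d j * ?h i j)" for i
  have harm: "?d i * S i = (\<Sum>k\<in>nbrs G i. S k)" if "i \<in> pverts G" for i
  proof -
    have "?d i * S i = (\<Sum>j\<in>pverts G. ?d j * (?d i * ?h i j))"
      by (simp add: S_def sum_distrib_left mult.left_commute)
    also have "\<dots> = (\<Sum>j\<in>pverts G. ?d j * ?d i + (\<Sum>k\<in>nbrs G i. ?d j * ?h k j)
        - (if i = j then ?d j * card (parcs G) else 0))"
      using that
      by (intro sum.cong refl, subst hitting_time_laplacian)
        (auto simp: distrib_left right_diff_distrib sum_distrib_left)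
    also have "\<dots> = (\<Sum>j\<in>pverts G. ?d j) * ?d i + (\<Sum>j\<in>pverts G. \<Sum>k\<in>nbrs G i. ?d j * ?h k j)
        - ?d i * card (parcs G)"
      using that pair_finite_verts by (simp add: sum.distrib sum_subtractf sum_distrib_right)
    also have "\<dots> = (\<Sum>k\<in>nbrs G i. S k)"
      by (subst sum.swap) (simp add: S_def card_parcs_eq_sum)
    finally show ?thesis .
  qed
  have const: "S x = S i" if "x \<in> pverts G" for x
  proof -
    have "S x - S i = 0"
      using i _ _ that
      by (rule harmonic_eq_0) (auto simp: right_diff_distrib sum_subtractf harm)
    then show ?thesis by simp
  qed
  have "(\<Sum>j\<in>pverts G. stationary G j * ?h x j) = S i / card (parcs G)" if "x \<in> pverts G" for x
    unfolding const[OF that, symmetric] by (simp add: S_def stationary_eq sum_divide_distrib)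
  then have "kemeny G = S i / card (parcs G)"
    unfolding kemeny_def using i by (intro the_equality) auto
  then show ?thesis
    by (simp add: S_def)
qed

end

text \<open>It suffices to reach one root \<open>r\<close>, since symmetry reverses the
  paths.\<close>

lemma walk_graphI:
  assumes fin: "finite V" and sub: "A \<subseteq> V \<times> V" and sym: "sym A" and irr: "irrefl A"
    and ne: "A \<noteq> {}" and reach: "\<And>x. x \<in> V \<Longrightarrow> (x, r) \<in> A\<^sup>*"
  shows "walk_graph \<lparr>pverts = V, parcs = A\<rparr>"
proof -
  have "(x, y) \<in> A\<^sup>*" if "x \<in> V" "y \<in> V" for x y
  proof -
    have "(r, y) \<in> A\<^sup>*"
      using sym_rtrancl[OF sym] reach[OF \<open>y \<in> V\<close>] by (rule symD)
    then show ?thesis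
      using reach[OF \<open>x \<in> V\<close>] by (rule rtrancl_trans[rotated])
  qed
  moreover have "finite A"
    using fin sub by (meson finite_SigmaI finite_subset)
  ultimately show ?thesis
    using assms
    by unfold_locales (auto simp: symmetric_def irrefl_def)
qed

section \<open>Kemeny's constant of a one-point union\<close>

definition stationary_hitting_time :: "'a pair_pre_digraph \<Rightarrow> 'a \<Rightarrow> real" where
  "stationary_hitting_time H v = (\<Sum>j\<in>pverts H. stationary H j * hitting_time H j v)"

definition graph_union :: "'a pair_pre_digraph \<Rightarrow> 'a pair_pre_digraph \<Rightarrow> 'a pair_pre_digraph" where
  "graph_union G B = \<lparr>pverts = pverts G \<union> pverts B, parcs = parcs G \<union> parcs B\<rparr>"

lemma (in walk_graph) stationary_hitting_time_eq:
  "stationary_hitting_time G v =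
    (\<Sum>j\<in>pverts G. card (nbrs G j) * hitting_time G j v) / card (parcs G)"
  by (simp add: stationary_hitting_time_def stationary_eq sum_divide_distrib)

lemma (in walk_graph) stationary_hitting_time_nonneg:
  "v \<in> pverts G \<Longrightarrow> 0 \<le> stationary_hitting_time G v"
  unfolding stationary_hitting_time_eq
  by (auto intro!: divide_nonneg_nonneg sum_nonneg mult_nonneg_nonneg hitting_time_nonneg)

text \<open>Degrees vanish outside the graph, so the two parts of a union can be added at every
  vertex without case distinctions.\<close>

lemma (in walk_graph) nbrs_outside: "i \<notin> pverts G \<Longrightarrow> nbrs G i = {}"
  using in_arcsD1 by (auto simp: nbrs_def)

locale one_sum = G: walk_graph G + B: walk_graph B
  for G B :: "'a pair_pre_digraph" +
  fixes v :: 'a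
  assumes inter_verts: "pverts G \<inter> pverts B = {v}"
begin

abbreviation "H \<equiv> graph_union G B"

lemma v_in: "v \<in> pverts G" "v \<in> pverts B"
  using inter_verts by auto

lemma walk_graph_union: "walk_graph H"
  unfolding graph_union_def
proof (rule walk_graphI)
  show "finite (pverts G \<union> pverts B)"
    using G.pair_finite_verts B.pair_finite_verts by simp
  show "parcs G \<union> parcs B \<subseteq> (pverts G \<union> pverts B) \<times> (pverts G \<union> pverts B)"
    using G.wellformed' B.wellformed' by auto
  show "sym (parcs G \<union> parcs B)"
    using G.arcs_symmetric B.arcs_symmetric by (auto intro: symI)
  show "irrefl (parcs G \<union> parcs B)"
    using G.no_loops' B.no_loops' by (auto simp: irrefl_def)
  show "parcs G \<union> parcs B \<noteq> {}"
    using G.parcs_nonempty by simp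
  show "(x, v) \<in> (parcs G \<union> parcs B)\<^sup>*" if "x \<in> pverts G \<union> pverts B" for x
    using that G.connected B.connected v_in
      rtrancl_mono[of "parcs G" "parcs G \<union> parcs B"] rtrancl_mono[of "parcs B" "parcs G \<union> parcs B"]
    by blast
qed

sublocale H: walk_graph H
  by (rule walk_graph_union)

lemma nbrs_union: "nbrs H i = nbrs G i \<union> nbrs B i"
  by (auto simp: nbrs_def graph_union_def)

text \<open>An arc in both parts would have both ends equal to \<open>v\<close>, hence be a
  loop.\<close>

lemma nbrs_disjoint: "nbrs G i \<inter> nbrs B i = {}"
proof -
  have False if k: "(i, k) \<in> parcs G" "(i, k) \<in> parcs B" for k
  proof -
    have "i = v" "k = v"
      using k G.wellformed' B.wellformed' inter_verts by blast+
    then show False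
      using k G.no_loops' by blast
  qed
  then show ?thesis
    by (auto simp: nbrs_def)
qed

lemma card_nbrs_union: "card (nbrs H i) = card (nbrs G i) + card (nbrs B i)"
  unfolding nbrs_union using nbrs_disjoint G.finite_nbrs B.finite_nbrs by (rule card_Un_disjoint[rotated 2])

lemma sum_nbrs_union:
  fixes f :: "'a \<Rightarrow> real"
  shows "sum f (nbrs H i) = sum f (nbrs G i) + sum f (nbrs B i)"
  unfolding nbrs_union using nbrs_disjoint G.finite_nbrs B.finite_nbrs by (rule sum.union_disjoint[rotated 2])

lemma card_parcs_union: "card (parcs H) = card (parcs G) + card (parcs B)"
proof -
  have "parcs G \<inter> parcs B = {}"
    using nbrs_disjoint by (fastforce simp: nbrs_def)
  then show ?thesis
    using G.pair_finite_arcs B.pair_finite_arcs by (simp add: graph_union_def card_Un_disjoint)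
qed

text \<open>
  The bracket with the factor \<open>r\<close> is the potential on \<open>G\<close> of a current from \<open>v\<close> to \<open>j\<close>; it accounts
  for the excursions that the walk makes into \<open>B\<close> before it reaches \<open>j\<close>.
\<close>

lemma hitting_time_union:
  assumes j: "j \<in> pverts G"
  shows "hitting_time H v j = hitting_time G v j +
    card (parcs B) / card (parcs G) * (hitting_time G v j + hitting_time G j v)"
proof -
  define r where "r = real (card (parcs B)) / card (parcs G)"
  define g where "g x = hitting_time G x j +
    r * (hitting_time G x j - hitting_time G x v + hitting_time G j v)" for x
  \<comment> \<open>A walk starting in \<open>B\<close> must pass through \<open>v\<close> before it
    can reach \<open>j\<close> in \<open>G\<close>.\<close>
  define f where "f x = (if x \<in> pverts G then g x else hitting_time B x v + g v)" for x
  have fG: "f x = g x" if "x \<in> pverts G" for x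
    using that by (simp add: f_def)
  have fB: "f x = hitting_time B x v + g v" if "x \<in> pverts B" for x
    using that inter_verts B.hitting_time_self[OF v_in(2)] by (cases "x = v") (auto simp: f_def)
  \<comment> \<open>The factor \<open>r\<close> is chosen so that the surplus
    \<open>card (parcs B)\<close> at \<open>v\<close> cancels the deficit of \<open>B\<close> there
    in \<open>stepB\<close>.\<close>
  have stepG: "card (nbrs G i) * f i =
      card (nbrs G i) + sum f (nbrs G i) + (if i = v then card (parcs B) else 0)" if "i \<noteq> j" for i
  proof (cases "i \<in> pverts G")
    case True
    have "sum f (nbrs G i) = sum g (nbrs G i)"
      using fG G.nbrs_in_verts by (intro sum.cong) auto
    also have "\<dots> = (\<Sum>k\<in>nbrs G i. hitting_time G k j) + r * ((\<Sum>k\<in>nbrs G i. hitting_time G k j)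
        - (\<Sum>k\<in>nbrs G i. hitting_time G k v) + card (nbrs G i) * hitting_time G j v)"
      by (simp add: g_def sum.distrib sum_subtractf flip: sum_distrib_left)
    finally have sum_f: "sum f (nbrs G i) = \<dots>" .
    have "card (nbrs G i) * f i = card (nbrs G i) * hitting_time G i j +
        r * (card (nbrs G i) * hitting_time G i j - card (nbrs G i) * hitting_time G i v
          + card (nbrs G i) * hitting_time G j v)"
      unfolding fG[OF True] g_def by (simp add: algebra_simps)
    moreover have "r * card (parcs G) = card (parcs B)"
      using G.parcs_nonempty G.pair_finite_arcs by (simp add: r_def)
    ultimately show ?thesis
      unfolding sum_f G.hitting_time_laplacian[OF True j] G.hitting_time_laplacian[OF True v_in(1)]
      using that by (simp add: algebra_simps)
  next
    case False
    then show ?thesis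
      using v_in by (auto simp: G.nbrs_outside)
  qed
  have stepB: "card (nbrs B i) * f i =
      card (nbrs B i) + sum f (nbrs B i) - (if i = v then card (parcs B) else 0)" for i
  proof (cases "i \<in> pverts B")
    case True
    have "sum f (nbrs B i) = (\<Sum>k\<in>nbrs B i. hitting_time B k v + g v)"
      using fB B.nbrs_in_verts by (intro sum.cong) auto
    then show ?thesis
      unfolding fB[OF True] distrib_left B.hitting_time_laplacian[OF True v_in(2)]
      by (simp add: sum.distrib)
  next
    case False
    then show ?thesis
      using v_in by (auto simp: B.nbrs_outside)
  qed
  have "hitting_time H v j = f v"
  proof (rule H.hitting_time_unique)
    show "j \<in> pverts H" "v \<in> pverts H"
      using j v_in by (auto simp: graph_union_def)
    show "f j = 0"
      using j by (simp add: fG g_def G.hitting_time_self)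
    show "card (nbrs H i) * f i = card (nbrs H i) + sum f (nbrs H i)" if "i \<noteq> j" for i
      using stepG[OF that] stepB[of i] by (simp add: card_nbrs_union sum_nbrs_union distrib_right)
  qed
  then show ?thesis
    using v_in G.hitting_time_self[OF v_in(1)] by (simp add: fG g_def r_def)
qed

text \<open>The contribution of the targets in \<open>G\<close> to the Kemeny sum of the union,
  started at the common vertex \<open>v\<close>.\<close>

lemma sum_hitting_time_union:
  "(\<Sum>j\<in>pverts G. card (nbrs G j) * hitting_time H v j) =
    (card (parcs G) + card (parcs B)) * kemeny G + card (parcs B) * stationary_hitting_time G v"
proof -
  have "(\<Sum>j\<in>pverts G. card (nbrs G j) * hitting_time H v j) =
      (1 + card (parcs B) / card (parcs G)) * (\<Sum>j\<in>pverts G. card (nbrs G j) * hitting_time G v j)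
      + card (parcs B) / card (parcs G) * (\<Sum>j\<in>pverts G. card (nbrs G j) * hitting_time G j v)"
    unfolding sum_distrib_left sum.distrib[symmetric]
    by (intro sum.cong refl) (simp add: hitting_time_union algebra_simps add_divide_distrib)
  then show ?thesis
    unfolding G.kemeny_eq[OF v_in(1)] G.stationary_hitting_time_eq
    using G.parcs_nonempty G.pair_finite_arcs by (simp add: divide_simps)
qed

end

lemma (in one_sum) kemeny_union:
  "kemeny (graph_union G B) = kemeny G + kemeny B +
    (card (parcs B) * stationary_hitting_time G v + card (parcs G) * stationary_hitting_time B v) /
    (card (parcs G) + card (parcs B))"
proof -
  \<comment> \<open>Exchanging the parts yields the contribution of the targets in
    \<open>B\<close>.\<close>
  interpret swap: one_sum B G v
    using inter_verts by unfold_locales auto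
  have swap: "graph_union B G = graph_union G B"
    by (auto simp: graph_union_def)
  have ext: "(\<Sum>j\<in>pverts H. card (nbrs X j) * hitting_time H v j) =
      (\<Sum>j\<in>pverts X. card (nbrs X j) * hitting_time H v j)"
    if "walk_graph X" "pverts X \<subseteq> pverts H" for X
    using that H.pair_finite_verts walk_graph.nbrs_outside[OF that(1)]
    by (intro sum.mono_neutral_right) auto
  have verts: "pverts G \<subseteq> pverts H" "pverts B \<subseteq> pverts H"
    by (auto simp: graph_union_def)
  have "v \<in> pverts H"
    using v_in by (simp add: graph_union_def)
  then have "kemeny H = (\<Sum>j\<in>pverts H. card (nbrs H j) * hitting_time H v j) / card (parcs H)"
    by (rule H.kemeny_eq)
  also have "(\<Sum>j\<in>pverts H. card (nbrs H j) * hitting_time H v j) =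
      (\<Sum>j\<in>pverts G. card (nbrs G j) * hitting_time H v j) +
      (\<Sum>j\<in>pverts B. card (nbrs B j) * hitting_time H v j)"
    using ext[OF G.walk_graph_axioms] ext[OF B.walk_graph_axioms] verts
    by (simp add: card_nbrs_union distrib_right sum.distrib)
  also have "\<dots> = (card (parcs G) + card (parcs B)) * (kemeny G + kemeny B) +
      (card (parcs B) * stationary_hitting_time G v + card (parcs G) * stationary_hitting_time B v)"
    unfolding sum_hitting_time_union swap.sum_hitting_time_union[unfolded swap]
    by (simp add: algebra_simps)
  finally show ?thesis
    using G.card_parcs_pos by (simp add: card_parcs_union add_divide_distrib)
qed

section \<open>Stars and complete graphs\<close>

definition star_graph :: "'a \<Rightarrow> 'a set \<Rightarrow> 'a pair_pre_digraph" where
  "star_graph v L = \<lparr>pverts = insert v L, parcs = {v} \<times> L \<union> L \<times> {v}\<rparr>"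

definition complete_graph :: "'a set \<Rightarrow> 'a pair_pre_digraph" where
  "complete_graph S = \<lparr>pverts = S, parcs = S \<times> S - Id\<rparr>"

lemma walk_graph_star:
  assumes "finite L" "L \<noteq> {}" "v \<notin> L"
  shows "walk_graph (star_graph v L)"
  unfolding star_graph_def
proof (rule walk_graphI)
  show "(x, v) \<in> ({v} \<times> L \<union> L \<times> {v})\<^sup>*" if "x \<in> insert v L" for x
    using that by auto
qed (use assms in \<open>auto simp: irrefl_def intro!: symI\<close>)

lemma walk_graph_complete:
  assumes "finite S" "2 \<le> card S"
  shows "walk_graph (complete_graph S)"
proof -
  obtain x y where xy: "x \<in> S" "y \<in> S" "x \<noteq> y"
    using assms by (metis card_2_iff' ex_card subset_iff)
  show ?thesis
    unfolding complete_graph_def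
  proof (rule walk_graphI)
    show "(z, x) \<in> (S \<times> S - Id)\<^sup>*" if "z \<in> S" for z
      using that xy by (cases "z = x") auto
    show "S \<times> S - Id \<noteq> {}"
      using xy by auto
  qed (use assms in \<open>auto simp: irrefl_def intro!: symI\<close>)
qed

section \<open>Hitting times on a star\<close>

context
  fixes L :: "'a set" and v :: 'a
  assumes L: "finite L" "L \<noteq> {}" "v \<notin> L"
begin

interpretation star: walk_graph "star_graph v L"
  using L by (rule walk_graph_star)

lemma nbrs_star: "nbrs (star_graph v L) v = L" "x \<in> L \<Longrightarrow> nbrs (star_graph v L) x = {v}"
  using L by (auto simp: nbrs_def star_graph_def)

lemma verts_star: "pverts (star_graph v L) = insert v L"
  by (simp add: star_graph_def)

lemma card_parcs_star: "card (parcs (star_graph v L)) = 2 * card L"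
  using L by (simp add: star.card_parcs_eq_sum verts_star nbrs_star)

lemma hitting_time_star_centre:
  assumes "x \<in> L"
  shows "hitting_time (star_graph v L) x v = 1"
  using star.hitting_time_unique[of v "\<lambda>y. if y = v then 0 else 1" x] assms L
  by (auto simp: verts_star nbrs_star)

text \<open>From the centre each attempt finds \<open>x\<close> with probability
  \<open>1 / card L\<close>, and a failed attempt costs two steps; another leaf is one step further
  away.\<close>

lemma hitting_time_star_leaf:
  assumes "x \<in> L"
  shows "hitting_time (star_graph v L) v x = 2 * real (card L) - 1"
proof -
  let ?n = "real (card L)"
  define f where "f y = (if y = x then 0 else if y = v then 2 * ?n - 1 else 2 * ?n)" for y
  have "sum f L = sum f (L - {x})"
    using assms L by (simp add: sum.remove f_def)
  also have "\<dots> = (\<Sum>y\<in>L - {x}. 2 * ?n)"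
    using L by (intro sum.cong) (auto simp: f_def)
  also have "\<dots> = (?n - 1) * (2 * ?n)"
    using assms L by (simp add: card_Diff_singleton of_nat_diff card_gt_0_iff Suc_le_eq)
  finally have sum_f: "sum f L = (?n - 1) * (2 * ?n)" .
  have "hitting_time (star_graph v L) v x = f v"
  proof (rule star.hitting_time_unique)
    have "x \<noteq> v"
      using assms L by blast
    fix i assume "i \<in> pverts (star_graph v L)" "i \<noteq> x"
    then show "card (nbrs (star_graph v L) i) * f i =
        card (nbrs (star_graph v L) i) + sum f (nbrs (star_graph v L) i)"
      using assms L \<open>x \<noteq> v\<close>
      by (cases "i = v") (auto simp: verts_star nbrs_star sum_f, auto simp: f_def algebra_simps)
  qed (use assms in \<open>auto simp: verts_star f_def\<close>)
  then show ?thesis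
    using assms L by (auto simp: f_def)
qed

lemma kemeny_star: "kemeny (star_graph v L) = real (card L) - 1 / 2"
  using L star.kemeny_eq[of v]
  by (simp add: verts_star nbrs_star card_parcs_star star.hitting_time_self
      hitting_time_star_leaf)

text \<open>The leaves carry half of the stationary mass and are one step from the centre.\<close>

lemma stationary_hitting_time_star: "stationary_hitting_time (star_graph v L) v = 1 / 2"
  using L star.hitting_time_self[of v]
  by (simp add: star.stationary_hitting_time_eq verts_star nbrs_star card_parcs_star hitting_time_star_centre)

end

section \<open>Hitting times on a complete graph\<close>

context
  fixes S :: "'a set"
  assumes S: "finite S" "2 \<le> card S"
begin

interpretation complete: walk_graph "complete_graph S"
  using S by (rule walk_graph_complete)

lemma nbrs_complete: "x \<in> S \<Longrightarrow> nbrs (complete_graph S) x = S - {x}"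
  by (auto simp: nbrs_def complete_graph_def)

lemma verts_complete: "pverts (complete_graph S) = S"
  by (simp add: complete_graph_def)

lemma card_parcs_complete: "card (parcs (complete_graph S)) = card S * (card S - 1)"
  using S by (simp add: complete.card_parcs_eq_sum verts_complete nbrs_complete card_Diff_singleton)

text \<open>The waiting time is geometric: off \<open>y\<close>, every step hits \<open>y\<close>
  with probability \<open>1 / (card S - 1)\<close>.\<close>

lemma hitting_time_complete:
  assumes "x \<in> S" "y \<in> S" "x \<noteq> y"
  shows "hitting_time (complete_graph S) x y = real (card S) - 1"
proof -
  let ?n = "real (card S)"
  define f where "f z = (if z = y then 0 else ?n - 1)" for z
  have "hitting_time (complete_graph S) x y = f x"
  proof (rule complete.hitting_time_unique)
    fix i assume "i \<in> pverts (complete_graph S)" and "i \<noteq> y"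
    then have i: "i \<in> S" "y \<in> S - {i}" "card (S - {i}) = card S - 1" "card (S - {i} - {y}) = card S - 2"
      using assms S by (auto simp: verts_complete card_Diff_singleton)
    have "sum f (S - {i}) = sum f (S - {i} - {y})"
      using i S by (subst sum.remove[of _ y]) (auto simp: f_def)
    also have "\<dots> = (\<Sum>z\<in>S - {i} - {y}. ?n - 1)"
      by (intro sum.cong) (auto simp: f_def)
    also have "\<dots> = (?n - 2) * (?n - 1)"
      using i S by (simp add: of_nat_diff)
    finally show "card (nbrs (complete_graph S) i) * f i =
        card (nbrs (complete_graph S) i) + sum f (nbrs (complete_graph S) i)"
      using i S \<open>i \<noteq> y\<close> by (simp add: nbrs_complete of_nat_diff f_def algebra_simps)
  qed (use assms in \<open>auto simp: verts_complete f_def\<close>)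
  then show ?thesis
    using assms by (simp add: f_def)
qed

text \<open>Hitting times on a complete graph are symmetric, so one computation serves for
  \<open>v\<close> as start (Kemeny's constant) and for \<open>v\<close> as target.\<close>

lemma sum_complete:
  fixes h :: "'a \<Rightarrow> real"
  assumes v: "v \<in> S" and h: "h v = 0" "\<And>j. j \<in> S \<Longrightarrow> j \<noteq> v \<Longrightarrow> h j = real (card S) - 1"
  shows "(\<Sum>j\<in>S. card (nbrs (complete_graph S) j) * h j) / card (parcs (complete_graph S)) =
    (real (card S) - 1)\<^sup>2 / card S"
proof -
  let ?n = "real (card S)"
  have n: "2 \<le> ?n"
    using S by simp
  have "(\<Sum>j\<in>S. card (nbrs (complete_graph S) j) * h j) = (\<Sum>j\<in>S - {v}. (?n - 1) * (?n - 1))"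
    using S v h by (simp add: sum.remove nbrs_complete card_Diff_singleton of_nat_diff)
  also have "\<dots> = (?n - 1) * ((?n - 1) * (?n - 1))"
    using S v by (simp add: card_Diff_singleton of_nat_diff)
  finally show ?thesis
    using S n by (simp add: card_parcs_complete of_nat_diff power2_eq_square)
qed

lemma kemeny_complete: "kemeny (complete_graph S) = (real (card S) - 1)\<^sup>2 / card S"
proof -
  obtain v where v: "v \<in> S"
    using S by fastforce
  then have "kemeny (complete_graph S) = (\<Sum>j\<in>S. card (nbrs (complete_graph S) j) *
      hitting_time (complete_graph S) v j) / card (parcs (complete_graph S))"
    using complete.kemeny_eq[of v] by (simp add: verts_complete)
  also have "\<dots> = (real (card S) - 1)\<^sup>2 / card S"
    using v complete.hitting_time_self by (intro sum_complete) (auto simp: verts_complete hitting_time_complete)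
  finally show ?thesis .
qed

lemma stationary_hitting_time_complete:
  assumes "v \<in> S"
  shows "stationary_hitting_time (complete_graph S) v = (real (card S) - 1)\<^sup>2 / card S"
  unfolding complete.stationary_hitting_time_eq verts_complete
  using assms complete.hitting_time_self
  by (intro sum_complete) (auto simp: verts_complete hitting_time_complete)

end

section \<open>Three pendant vertices versus a complete graph on four vertices\<close>

text \<open>Every vertex has a neighbour, so a single edge already determines the vertex
  set.\<close>

lemma (in walk_graph) is_P2_iff_card_edges: "is_P2 G \<longleftrightarrow> card (edges G) = 1"
proof
  assume "is_P2 G"
  then have "card (parcs G) = 2"
    by (auto simp: is_P2_def)
  then show "card (edges G) = 1"
    by (simp add: card_parcs_eq)
next
  assume "card (edges G) = 1"
  then have two: "card (parcs G) = 2"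
    by (simp add: card_parcs_eq)
  obtain u w where uw: "(u, w) \<in> parcs G"
    using parcs_nonempty by auto
  then have wu: "(w, u) \<in> parcs G" and ne: "u \<noteq> w"
    using arcs_symmetric no_loops' by blast+
  have arcs: "parcs G = {(u, w), (w, u)}"
    using card_subset_eq[OF pair_finite_arcs, of "{(u, w), (w, u)}"] two uw wu ne by simp
  have "pverts G = {u, w}"
  proof
    show "{u, w} \<subseteq> pverts G"
      using uw in_arcsD1 in_arcsD2 by blast
    show "pverts G \<subseteq> {u, w}"
      using nbrs_nonempty arcs by (fastforce simp: nbrs_def)
  qed
  then have "G = \<lparr>pverts = {u, w}, parcs = {(u, w), (w, u)}\<rparr>"
    using arcs by simp
  then show "is_P2 G"
    using ne by (auto simp: is_P2_def)
qed

lemma stationary_hitting_time_P2: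
  assumes "is_P2 G" "v \<in> pverts G"
  shows "stationary_hitting_time G v = 1 / 2"
proof -
  obtain u w where uw: "u \<noteq> w" "G = \<lparr>pverts = {u, w}, parcs = {(u, w), (w, u)}\<rparr>"
    using assms by (auto simp: is_P2_def)
  then have "G = complete_graph {u, w}" "v \<in> {u, w}"
    using assms(2) by (auto simp: complete_graph_def)
  then show ?thesis
    using stationary_hitting_time_complete[of "{u, w}" v] uw(1) by simp
qed

theorem theorem4p16:
  fixes G Gbar Gstar :: "'a pair_pre_digraph" and v a b c :: 'a
  assumes "pair_graph G"
    and "Digraph_Component.connected (with_proj G)"
    and "card (edges G) \<ge> 1"
    and "v \<in> pverts G"
    and "distinct [a, b, c]"
    and "a \<notin> pverts G" and "b \<notin> pverts G" and "c \<notin> pverts G"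
    and "Gbar = add_pendant (add_pendant (add_pendant G v a) v b) v c"
    and "Gstar = add_edge (add_edge (add_edge Gbar a b) b c) a c"
  shows "kemeny Gstar \<ge> kemeny Gbar \<and> (kemeny Gstar = kemeny Gbar \<longleftrightarrow> is_P2 G)"
proof -
  interpret pair_graph G by fact
  interpret G: walk_graph G
  proof
    show "parcs G \<noteq> {}"
      using assms(3) by (auto simp: edges_def)
    \<comment> \<open>Symmetry of the arcs upgrades the library's notion of connectedness to
      directed reachability.\<close>
    have "strongly_connected (with_proj G)"
      using symmetric_connected_imp_strongly_connected pair_sym_arcs assms(2) by blast
    then show "(x, y) \<in> (parcs G)\<^sup>*" if "x \<in> pverts G" "y \<in> pverts G" for x y
      using that by (fastforce simp: strongly_connected_def dest: reachable_rtranclI)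
  qed
  define m where "m = real (card (edges G))"
  define \<alpha> where "\<alpha> = stationary_hitting_time G v"
  have m: "1 \<le> m"
    using assms(3) by (simp add: m_def)
  have \<alpha>: "0 \<le> \<alpha>"
    using G.stationary_hitting_time_nonneg assms(4) by (simp add: \<alpha>_def)
  have arcs: "real (card (parcs G)) = 2 * m"
    by (simp add: G.card_parcs_eq m_def)
  have leaves: "card {a, b, c} = 3" "card {v, a, b, c} = 4" "v \<notin> {a, b, c}"
    using assms by (auto simp: card_insert_if)

  interpret star: walk_graph "star_graph v {a, b, c}"
    using leaves by (intro walk_graph_star) auto
  interpret bar: one_sum G "star_graph v {a, b, c}" v
    using assms by unfold_locales (auto simp: star_graph_def)
  have "Gbar = graph_union G (star_graph v {a, b, c})"
    using assms
    by (intro pair_pre_digraph.equality) (auto simp: add_pendant_def add_edge_def graph_union_def star_graph_def)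
  \<comment> \<open>The union formula counts arcs: \<open>2 * m\<close> for \<open>G\<close>, 6 for
    the star, and 12 for the complete graph below.\<close>
  then have bar: "kemeny Gbar = kemeny G + 5 / 2 + (6 * \<alpha> + m) / (2 * m + 6)"
    using bar.kemeny_union leaves arcs
    by (simp add: kemeny_star stationary_hitting_time_star card_parcs_star \<alpha>_def)

  interpret K4: walk_graph "complete_graph {v, a, b, c}"
    using leaves by (intro walk_graph_complete) auto
  interpret star': one_sum G "complete_graph {v, a, b, c}" v
    using assms by unfold_locales (auto simp: complete_graph_def)
  have "Gstar = graph_union G (complete_graph {v, a, b, c})"
    using assms
    by (intro pair_pre_digraph.equality) (auto simp: add_pendant_def add_edge_def graph_union_def complete_graph_def)
  then have star: "kemeny Gstar = kemeny G + 9 / 4 + (12 * \<alpha> + 2 * m * (9 / 4)) / (2 * m + 12)"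
    using star'.kemeny_union leaves arcs
    by (simp add: kemeny_complete stationary_hitting_time_complete card_parcs_complete \<alpha>_def)

  have diff: "kemeny Gstar - kemeny Gbar =
      (3 * m * \<alpha> + 3 / 2 * (m\<^sup>2 + m - 3)) / ((m + 3) * (m + 6))"
    unfolding bar star using m by (simp add: divide_simps) (simp add: algebra_simps power2_eq_square)
  show ?thesis
  proof (cases "is_P2 G")
    case True
    then have "m = 1" "\<alpha> = 1 / 2"
      using G.is_P2_iff_card_edges stationary_hitting_time_P2 assms(4) by (simp_all add: m_def \<alpha>_def)
    then have "kemeny Gstar - kemeny Gbar = 0"
      unfolding diff by simp
    then show ?thesis
      using True by simp
  next
    case False
    then have "2 \<le> m"
      using G.is_P2_iff_card_edges assms(3) by (simp add: m_def)
    \<comment> \<open>With \<open>m\<^sup>2\<close> at least 4, the bracket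
      \<open>m\<^sup>2 + m - 3\<close> is positive.\<close>
    then have "2\<^sup>2 \<le> m\<^sup>2"
      by (intro power_mono) auto
    then have "0 < 3 * m * \<alpha> + 3 / 2 * (m\<^sup>2 + m - 3)"
      using \<alpha> m by (intro add_nonneg_pos) auto
    then have "0 < kemeny Gstar - kemeny Gbar"
      unfolding diff using m by (intro divide_pos_pos mult_pos_pos) auto
    then show ?thesis
      using False by simp
  qed
qed

end
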